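(* wBIL is equivalential with equivalence formulas $\Delta(x,y)=\{(\neg{\sim})^n(x\leftrightarrow y)\mid n\in\mathbb{N}\}$; that is: (R) $\vdash_w\Delta(x,x)$; (MP') $x,\Delta(x,y)\vdash_w y$; (Re) for every connective $\lambda\in\{\top,\bot,\wedge,\vee,\to,\prec\}$ of arity $n$: $\Delta(x_1,y_1),\dots,\Delta(x_n,y_n)\vdash_w\Delta(\lambda x_1\dots x_n,\lambda y_1\dots y_n)$.
   Context: Fix a countably infinite set $\mathrm{Prop}$ of propositional variables (here $x,y,x_i,y_i$ denote distinct variables). Bi-intuitionistic formulas are generated by $\phi ::= p \mid \bot \mid \top \mid \phi\wedge\phi \mid \phi\vee\phi \mid \phi\to\phi \mid \phi\prec\phi$ with $p\in\mathrm{Prop}$ ($\prec$ is exclusion). Abbreviations: $\neg\phi := \phi\to\bot$, ${\sim}\phi := \top\prec\phi$, $\phi\leftrightarrow\psi := (\phi\to\psi)\wedge(\psi\to\phi)$, $(\neg{\sim})^0\phi:=\phi$, $(\neg{\sim})^{n+1}\phi:=\neg{\sim}(\neg{\sim})^n\phi$. An axiom is any instance of: (A1) $\phi\to(\psi\to\phi)$; (A2) $(\phi\to(\psi\to\chi))\to((\phi\to\psi)\to(\phi\to\chi))$; (A3) $\phi\to(\phi\vee\psi)$; (A4) $\psi\to(\phi\vee\psi)$; (A5) $(\phi\to\chi)\to((\psi\to\chi)\to((\phi\vee\psi)\to\chi))$; (A6) $(\phi\wedge\psi)\to\phi$; (A7) $(\phi\wedge\psi)\to\psi$; (A8) $(\chi\to\phi)\to((\chi\to\psi)\to(\chi\to(\phi\wedge\psi)))$;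 (A9) $\bot\to\phi$; (A10) $\phi\to\top$; (A11) $\phi\to(\psi\vee(\phi\prec\psi))$; (A12) $(\phi\prec\psi)\to{\sim}(\phi\to\psi)$; (A13) $((\phi\prec\psi)\prec\chi)\to(\phi\prec(\psi\vee\chi))$; (A14) $\neg(\phi\prec\psi)\to(\phi\to\psi)$. wBIL is the relation $\Gamma\vdash_w\phi$ holding iff $\Gamma\vdash\phi$ is derivable with: (Ax) $\Gamma\vdash\phi$ for any axiom $\phi$; (El) $\Gamma\vdash\phi$ if $\phi\in\Gamma$; (MP) from $\Gamma\vdash\phi$ and $\Gamma\vdash\phi\to\psi$ infer $\Gamma\vdash\psi$; (wDN) from $\emptyset\vdash\phi$ infer $\Gamma\vdash\neg{\sim}\phi$. $\Delta(\phi,\psi)$ denotes $\Delta(x,y)$ with $x,y$ replaced by $\phi,\psi$; a set on the right of $\vdash_w$ means each member is derivable; commas on the left denote union. *)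

theory Defs
  imports "HOL-Library.Countable" "HOL-Library.Infinite_Typeclass"
begin

datatype 'p form =
    Var 'p
  | Bot  (\<open>\<^bold>\<bottom>\<close>)
  | Top  (\<open>\<^bold>\<top>\<close>)
  | And "'p form" "'p form"  (infixr \<open>\<^bold>\<and>\<close> 75)
  | Or "'p form" "'p form"  (infixr \<open>\<^bold>\<or>\<close> 70)
  | Imp "'p form" "'p form"  (infixr \<open>\<^bold>\<rightarrow>\<close> 65)
  | Excl "'p form" "'p form"  (infixl \<open>\<^bold>\<prec>\<close> 65)

definition Neg :: "'p form \<Rightarrow> 'p form"  (\<open>\<^bold>\<not> _\<close> [80] 80) where
  "\<^bold>\<not> \<phi> = (\<phi> \<^bold>\<rightarrow> \<^bold>\<bottom>)"

definition WNeg :: "'p form \<Rightarrow> 'p form"  (\<open>\<^bold>\<sim> _\<close> [80] 80) where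
  "\<^bold>\<sim> \<phi> = (\<^bold>\<top> \<^bold>\<prec> \<phi>)"

definition Iff :: "'p form \<Rightarrow> 'p form \<Rightarrow> 'p form"  (infix \<open>\<^bold>\<leftrightarrow>\<close> 60) where
  "(\<phi> \<^bold>\<leftrightarrow> \<psi>) = ((\<phi> \<^bold>\<rightarrow> \<psi>) \<^bold>\<and> (\<psi> \<^bold>\<rightarrow> \<phi>))"

primrec NegWNeg :: "nat \<Rightarrow> 'p form \<Rightarrow> 'p form" where
  "NegWNeg 0 \<phi> = \<phi>"
| "NegWNeg (Suc n) \<phi> = \<^bold>\<not> \<^bold>\<sim> (NegWNeg n \<phi>)"

inductive ax :: "'p form \<Rightarrow> bool" where
  A1: "ax (\<phi> \<^bold>\<rightarrow> (\<psi> \<^bold>\<rightarrow> \<phi>))"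
| A2: "ax ((\<phi> \<^bold>\<rightarrow> (\<psi> \<^bold>\<rightarrow> \<chi>)) \<^bold>\<rightarrow> ((\<phi> \<^bold>\<rightarrow> \<psi>) \<^bold>\<rightarrow> (\<phi> \<^bold>\<rightarrow> \<chi>)))"
| A3: "ax (\<phi> \<^bold>\<rightarrow> (\<phi> \<^bold>\<or> \<psi>))"
| A4: "ax (\<psi> \<^bold>\<rightarrow> (\<phi> \<^bold>\<or> \<psi>))"
| A5: "ax ((\<phi> \<^bold>\<rightarrow> \<chi>) \<^bold>\<rightarrow> ((\<psi> \<^bold>\<rightarrow> \<chi>) \<^bold>\<rightarrow> ((\<phi> \<^bold>\<or> \<psi>) \<^bold>\<rightarrow> \<chi>)))"
| A6: "ax ((\<phi> \<^bold>\<and> \<psi>) \<^bold>\<rightarrow> \<phi>)"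
| A7: "ax ((\<phi> \<^bold>\<and> \<psi>) \<^bold>\<rightarrow> \<psi>)"
| A8: "ax ((\<chi> \<^bold>\<rightarrow> \<phi>) \<^bold>\<rightarrow> ((\<chi> \<^bold>\<rightarrow> \<psi>) \<^bold>\<rightarrow> (\<chi> \<^bold>\<rightarrow> (\<phi> \<^bold>\<and> \<psi>))))"
| A9: "ax (\<^bold>\<bottom> \<^bold>\<rightarrow> \<phi>)"
| A10: "ax (\<phi> \<^bold>\<rightarrow> \<^bold>\<top>)"
| A11: "ax (\<phi> \<^bold>\<rightarrow> (\<psi> \<^bold>\<or> (\<phi> \<^bold>\<prec> \<psi>)))"
| A12: "ax ((\<phi> \<^bold>\<prec> \<psi>) \<^bold>\<rightarrow> \<^bold>\<sim> (\<phi> \<^bold>\<rightarrow> \<psi>))"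
| A13: "ax (((\<phi> \<^bold>\<prec> \<psi>) \<^bold>\<prec> \<chi>) \<^bold>\<rightarrow> (\<phi> \<^bold>\<prec> (\<psi> \<^bold>\<or> \<chi>)))"
| A14: "ax (\<^bold>\<not> (\<phi> \<^bold>\<prec> \<psi>) \<^bold>\<rightarrow> (\<phi> \<^bold>\<rightarrow> \<psi>))"

inductive wBIL :: "'p form set \<Rightarrow> 'p form \<Rightarrow> bool"  (infix \<open>\<turnstile>\<^sub>w\<close> 50) where
  Ax: "ax \<phi> \<Longrightarrow> \<Gamma> \<turnstile>\<^sub>w \<phi>"
| El: "\<phi> \<in> \<Gamma> \<Longrightarrow> \<Gamma> \<turnstile>\<^sub>w \<phi>"
| MP: "\<Gamma> \<turnstile>\<^sub>w \<phi> \<Longrightarrow> \<Gamma> \<turnstile>\<^sub>w \<phi> \<^bold>\<rightarrow> \<psi> \<Longrightarrow> \<Gamma> \<turnstile>\<^sub>w \<psi>"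
| wDN: "{} \<turnstile>\<^sub>w \<phi> \<Longrightarrow> \<Gamma> \<turnstile>\<^sub>w \<^bold>\<not> \<^bold>\<sim> \<phi>"

definition wBIL_set :: "'p form set \<Rightarrow> 'p form set \<Rightarrow> bool"  (infix \<open>\<tturnstile>\<^sub>w\<close> 50) where
  "\<Gamma> \<tturnstile>\<^sub>w \<Sigma> \<longleftrightarrow> (\<forall>\<phi>\<in>\<Sigma>. \<Gamma> \<turnstile>\<^sub>w \<phi>)"

primrec subst :: "('p \<Rightarrow> 'p form) \<Rightarrow> 'p form \<Rightarrow> 'p form" where
  "subst \<sigma> (Var p) = \<sigma> p"
| "subst \<sigma> \<^bold>\<bottom> = \<^bold>\<bottom>"
| "subst \<sigma> \<^bold>\<top> = \<^bold>\<top>"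
| "subst \<sigma> (\<phi> \<^bold>\<and> \<psi>) = subst \<sigma> \<phi> \<^bold>\<and> subst \<sigma> \<psi>"
| "subst \<sigma> (\<phi> \<^bold>\<or> \<psi>) = subst \<sigma> \<phi> \<^bold>\<or> subst \<sigma> \<psi>"
| "subst \<sigma> (\<phi> \<^bold>\<rightarrow> \<psi>) = subst \<sigma> \<phi> \<^bold>\<rightarrow> subst \<sigma> \<psi>"
| "subst \<sigma> (\<phi> \<^bold>\<prec> \<psi>) = subst \<sigma> \<phi> \<^bold>\<prec> subst \<sigma> \<psi>"

text \<open>For a set \<open>D\<close> of formulas in the variables \<open>x\<close> and \<open>y\<close>, \<open>inst2 x y D \<phi> \<psi>\<close> is \<open>D(\<phi>, \<psi>)\<close>:
  \<open>x\<close> and \<open>y\<close> are replaced simultaneously.\<close>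

definition inst2 :: "'p \<Rightarrow> 'p \<Rightarrow> 'p form set \<Rightarrow> 'p form \<Rightarrow> 'p form \<Rightarrow> 'p form set" where
  "inst2 x y D \<phi> \<psi> = subst (Var(x := \<phi>, y := \<psi>)) ` D"

definition Delta :: "'p \<Rightarrow> 'p \<Rightarrow> 'p form set" where
  "Delta x y = {NegWNeg n (Var x \<^bold>\<leftrightarrow> Var y) | n. True}"

datatype conn = CTop | CBot | CAnd | COr | CImp | CExcl

fun arity :: "conn \<Rightarrow> nat" where
  "arity CTop = 0"
| "arity CBot = 0"
| "arity CAnd = 2"
| "arity COr = 2"
| "arity CImp = 2"
| "arity CExcl = 2"

text \<open>\<open>conn_app c \<phi>s\<close> is meaningful only if \<open>length \<phi>s = arity c\<close>.\<close>

fun conn_app :: "conn \<Rightarrow> 'p form list \<Rightarrow> 'p form" where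
  "conn_app CTop [] = \<^bold>\<top>"
| "conn_app CBot [] = \<^bold>\<bottom>"
| "conn_app CAnd [\<phi>, \<psi>] = \<phi> \<^bold>\<and> \<psi>"
| "conn_app COr [\<phi>, \<psi>] = \<phi> \<^bold>\<or> \<psi>"
| "conn_app CImp [\<phi>, \<psi>] = \<phi> \<^bold>\<rightarrow> \<psi>"
| "conn_app CExcl [\<phi>, \<psi>] = \<phi> \<^bold>\<prec> \<psi>"
| "conn_app _ _ = undefined"

end

theory Submission
  imports Defs
begin

text \<open>
  The operator \<open>\<not>\<sim>\<close> behaves like a normal box: if \<open>\<alpha>, \<beta> \<turnstile> \<gamma>\<close> then
  \<open>\<not>\<sim>\<alpha>, \<not>\<sim>\<beta> \<turnstile> \<not>\<sim>\<gamma>\<close>, and this iterates. Since \<open>\<leftrightarrow>\<close> is a congruence for the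
  intuitionistic connectives, \<open>(\<not>\<sim>)\<^sup>n\<close> of the argument equivalences yields \<open>(\<not>\<sim>)\<^sup>n\<close> of the
  compound one. Exclusion is only a congruence one box deeper: axioms A12, A13, A14 give the local
  dual residuation \<open>\<not>\<sim>(\<phi> \<rightarrow> \<psi> \<or> \<chi>) \<turnstile> (\<phi> \<prec> \<psi>) \<rightarrow> \<chi>\<close>, so for \<open>\<prec>\<close> the formula of index \<open>n\<close> is
  derived from those of index \<open>n + 1\<close>.
\<close>

section \<open>Natural deduction\<close>

lemma wBIL_mono: "\<Gamma> \<turnstile>\<^sub>w \<phi> \<Longrightarrow> \<Gamma> \<subseteq> \<Gamma>' \<Longrightarrow> \<Gamma>' \<turnstile>\<^sub>w \<phi>"
proof (induction arbitrary: \<Gamma>' rule: wBIL.induct)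
  case (MP \<Gamma> \<phi> \<psi>)
  then show ?case by (blast intro: wBIL.MP[of _ \<phi>])
qed (auto intro: Ax El wDN)

lemma Imp_const: "\<Gamma> \<turnstile>\<^sub>w \<psi> \<Longrightarrow> \<Gamma> \<turnstile>\<^sub>w \<phi> \<^bold>\<rightarrow> \<psi>"
  by (erule MP[OF _ Ax[OF A1]])

lemma Imp_refl: "\<Gamma> \<turnstile>\<^sub>w \<phi> \<^bold>\<rightarrow> \<phi>"
  by (rule MP[OF Ax[OF A1[of _ \<phi>]] MP[OF Ax[OF A1[of _ "\<phi> \<^bold>\<rightarrow> \<phi>"]] Ax[OF A2]]])

text \<open>Holds in spite of the rule \<open>wDN\<close>: its premise has an empty context, so the
  discharged hypothesis cannot have been used there, and its conclusion is available in every
  context. \<open>MP\<close> is handled by \<open>A2\<close>.\<close>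

theorem deduction:
  assumes "insert \<phi> \<Gamma> \<turnstile>\<^sub>w \<psi>"
  shows "\<Gamma> \<turnstile>\<^sub>w \<phi> \<^bold>\<rightarrow> \<psi>"
  using assms
proof (induction "insert \<phi> \<Gamma>" \<psi> rule: wBIL.induct)
  case (El \<psi>)
  then show ?case by (auto intro: Imp_refl Imp_const wBIL.El)
next
  case (MP \<psi> \<chi>)
  then show ?case by (metis wBIL.MP Ax ax.A2)
qed (auto intro: Imp_const Ax wDN)

lemma And_intro: "\<Gamma> \<turnstile>\<^sub>w \<phi> \<Longrightarrow> \<Gamma> \<turnstile>\<^sub>w \<psi> \<Longrightarrow> \<Gamma> \<turnstile>\<^sub>w \<phi> \<^bold>\<and> \<psi>"
  \<comment> \<open>\<open>A8\<close> wants two implications with a common derivable antecedent;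
    \<open>\<phi>\<close> itself serves as that antecedent.\<close>
  by (rule MP[OF _ MP[OF Imp_const MP[OF Imp_const Ax[OF A8]]], of \<Gamma> \<phi>])

lemma And_elim1: "\<Gamma> \<turnstile>\<^sub>w \<phi> \<^bold>\<and> \<psi> \<Longrightarrow> \<Gamma> \<turnstile>\<^sub>w \<phi>"
  by (erule MP[OF _ Ax[OF A6]])

lemma And_elim2: "\<Gamma> \<turnstile>\<^sub>w \<phi> \<^bold>\<and> \<psi> \<Longrightarrow> \<Gamma> \<turnstile>\<^sub>w \<psi>"
  by (erule MP[OF _ Ax[OF A7]])

lemma Or_intro1: "\<Gamma> \<turnstile>\<^sub>w \<phi> \<Longrightarrow> \<Gamma> \<turnstile>\<^sub>w \<phi> \<^bold>\<or> \<psi>"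
  by (erule MP[OF _ Ax[OF A3]])

lemma Or_intro2: "\<Gamma> \<turnstile>\<^sub>w \<psi> \<Longrightarrow> \<Gamma> \<turnstile>\<^sub>w \<phi> \<^bold>\<or> \<psi>"
  by (erule MP[OF _ Ax[OF A4]])

lemma Or_elim:
  "\<Gamma> \<turnstile>\<^sub>w \<phi> \<^bold>\<or> \<psi> \<Longrightarrow> insert \<phi> \<Gamma> \<turnstile>\<^sub>w \<chi> \<Longrightarrow> insert \<psi> \<Gamma> \<turnstile>\<^sub>w \<chi> \<Longrightarrow> \<Gamma> \<turnstile>\<^sub>w \<chi>"
  by (rule MP[OF _ MP[OF deduction MP[OF deduction Ax[OF A5]]]])

lemma Top_intro: "\<Gamma> \<turnstile>\<^sub>w \<^bold>\<top>"
  by (rule MP[OF Ax[OF A9] Ax[OF A10]])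

lemma Neg_intro: "insert \<phi> \<Gamma> \<turnstile>\<^sub>w \<^bold>\<bottom> \<Longrightarrow> \<Gamma> \<turnstile>\<^sub>w \<^bold>\<not> \<phi>"
  by (simp add: Neg_def deduction)

lemma Neg_elim: "\<Gamma> \<turnstile>\<^sub>w \<^bold>\<not> \<phi> \<Longrightarrow> \<Gamma> \<turnstile>\<^sub>w \<phi> \<Longrightarrow> \<Gamma> \<turnstile>\<^sub>w \<^bold>\<bottom>"
  by (auto simp: Neg_def intro: MP)

lemma Iff_intro: "insert \<phi> \<Gamma> \<turnstile>\<^sub>w \<psi> \<Longrightarrow> insert \<psi> \<Gamma> \<turnstile>\<^sub>w \<phi> \<Longrightarrow> \<Gamma> \<turnstile>\<^sub>w \<phi> \<^bold>\<leftrightarrow> \<psi>"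
  by (simp add: Iff_def And_intro deduction)

lemma Iff_elim1: "\<phi> \<^bold>\<leftrightarrow> \<psi> \<in> \<Gamma> \<Longrightarrow> \<Gamma> \<turnstile>\<^sub>w \<phi> \<Longrightarrow> \<Gamma> \<turnstile>\<^sub>w \<psi>"
  unfolding Iff_def by (erule MP[OF _ And_elim1[OF El]])

lemma Iff_elim2: "\<phi> \<^bold>\<leftrightarrow> \<psi> \<in> \<Gamma> \<Longrightarrow> \<Gamma> \<turnstile>\<^sub>w \<psi> \<Longrightarrow> \<Gamma> \<turnstile>\<^sub>w \<phi>"
  unfolding Iff_def by (erule MP[OF _ And_elim2[OF El]])

lemma Iff_refl: "\<Gamma> \<turnstile>\<^sub>w \<phi> \<^bold>\<leftrightarrow> \<phi>"
  by (simp add: Iff_intro El)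

lemma Excl_cases: "\<Gamma> \<turnstile>\<^sub>w \<phi> \<Longrightarrow> \<Gamma> \<turnstile>\<^sub>w \<psi> \<^bold>\<or> (\<phi> \<^bold>\<prec> \<psi>)"
  by (erule MP[OF _ Ax[OF A11]])

lemma WNeg_excluded_middle: "\<Gamma> \<turnstile>\<^sub>w \<phi> \<^bold>\<or> \<^bold>\<sim> \<phi>"
  unfolding WNeg_def by (rule Excl_cases[OF Top_intro])

section \<open>Dual residuation and the box-like behaviour of \<open>\<not>\<sim>\<close>\<close>

text \<open>By \<open>A14\<close> it suffices to refute (\<phi> \<prec> \<psi>) \<prec> \<chi>.
  \<open>A13\<close> regroups this exclusion and \<open>A12\<close> turns it into \<sim>(\<phi>
  \<rightarrow> \<psi> \<or> \<chi>), which the assumption denies.\<close>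

lemma dual_residuation:
  assumes "\<Gamma> \<turnstile>\<^sub>w \<^bold>\<not> \<^bold>\<sim> (\<phi> \<^bold>\<rightarrow> \<psi> \<^bold>\<or> \<chi>)"
  shows "\<Gamma> \<turnstile>\<^sub>w (\<phi> \<^bold>\<prec> \<psi>) \<^bold>\<rightarrow> \<chi>"
proof -
  let ?\<Gamma> = "insert ((\<phi> \<^bold>\<prec> \<psi>) \<^bold>\<prec> \<chi>) \<Gamma>"
  have "?\<Gamma> \<turnstile>\<^sub>w \<phi> \<^bold>\<prec> (\<psi> \<^bold>\<or> \<chi>)"
    by (rule MP[OF _ Ax[OF A13]]) (simp add: El)
  then have sim: "?\<Gamma> \<turnstile>\<^sub>w \<^bold>\<sim> (\<phi> \<^bold>\<rightarrow> \<psi> \<^bold>\<or> \<chi>)"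
    by (rule MP[OF _ Ax[OF A12]])
  have "?\<Gamma> \<turnstile>\<^sub>w \<^bold>\<not> \<^bold>\<sim> (\<phi> \<^bold>\<rightarrow> \<psi> \<^bold>\<or> \<chi>)"
    using assms by (rule wBIL_mono) blast
  then have "\<Gamma> \<turnstile>\<^sub>w \<^bold>\<not> ((\<phi> \<^bold>\<prec> \<psi>) \<^bold>\<prec> \<chi>)"
    by (rule Neg_intro[OF Neg_elim[OF _ sim]])
  then show ?thesis
    by (rule MP[OF _ Ax[OF A14]])
qed

text \<open>Argues by contraposition: \<sim>\<gamma> implies \<sim>\<alpha> \<or> \<sim>\<beta>, and
  the boxed premises refute both disjuncts. The entailment is assumed without side formulas from
  \<Gamma>, since only theorems can be boxed.\<close>

lemma NegWNeg_1_mono2: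
  assumes "{\<alpha>, \<beta>} \<turnstile>\<^sub>w \<gamma>" and \<alpha>: "\<Gamma> \<turnstile>\<^sub>w \<^bold>\<not> \<^bold>\<sim> \<alpha>" and \<beta>: "\<Gamma> \<turnstile>\<^sub>w \<^bold>\<not> \<^bold>\<sim> \<beta>"
  shows "\<Gamma> \<turnstile>\<^sub>w \<^bold>\<not> \<^bold>\<sim> \<gamma>"
proof -
  let ?\<delta> = "\<^bold>\<sim> \<alpha> \<^bold>\<or> \<^bold>\<sim> \<beta>"
  \<comment> \<open>Excluded middle for \<sim> splits on \<alpha> and then on \<beta>: if both hold,
    so does \<gamma>; otherwise a disjunct of \<open>?\<delta>\<close> holds. The idle hypothesis
    \<top> yields an implication from \<top>, as residuation requires.\<close>
  have "{\<^bold>\<top>} \<turnstile>\<^sub>w \<gamma> \<^bold>\<or> ?\<delta>"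
  proof (rule Or_elim[OF WNeg_excluded_middle[of _ \<alpha>]])
    show "{\<alpha>, \<^bold>\<top>} \<turnstile>\<^sub>w \<gamma> \<^bold>\<or> ?\<delta>"
    proof (rule Or_elim[OF WNeg_excluded_middle[of _ \<beta>]])
      show "{\<beta>, \<alpha>, \<^bold>\<top>} \<turnstile>\<^sub>w \<gamma> \<^bold>\<or> ?\<delta>"
        by (rule Or_intro1[OF wBIL_mono[OF assms(1)]]) blast
    qed (simp add: Or_intro2 El)
  qed (simp add: Or_intro1 Or_intro2 El)
  then have "{} \<turnstile>\<^sub>w \<^bold>\<top> \<^bold>\<rightarrow> \<gamma> \<^bold>\<or> ?\<delta>"
    by (rule deduction)
  \<comment> \<open>Since \<sim>\<gamma> is \<top> \<prec> \<gamma>, this is dual residuation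
    applied to the theorem just obtained, boxed by \<open>wDN\<close>.\<close>
  then have imp: "\<Gamma>' \<turnstile>\<^sub>w \<^bold>\<sim> \<gamma> \<^bold>\<rightarrow> ?\<delta>" for \<Gamma>'
    unfolding WNeg_def[of \<gamma>] by (intro dual_residuation wDN)
  show ?thesis
  proof (rule Neg_intro[OF Or_elim[of _ "\<^bold>\<sim> \<alpha>" "\<^bold>\<sim> \<beta>"]])
    show "insert (\<^bold>\<sim> \<gamma>) \<Gamma> \<turnstile>\<^sub>w ?\<delta>"
      by (rule MP[OF _ imp]) (simp add: El)
    show "insert (\<^bold>\<sim> \<alpha>) (insert (\<^bold>\<sim> \<gamma>) \<Gamma>) \<turnstile>\<^sub>w \<^bold>\<bottom>"
      by (rule Neg_elim[OF wBIL_mono[OF \<alpha>]]) (auto intro: El)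
    show "insert (\<^bold>\<sim> \<beta>) (insert (\<^bold>\<sim> \<gamma>) \<Gamma>) \<turnstile>\<^sub>w \<^bold>\<bottom>"
      by (rule Neg_elim[OF wBIL_mono[OF \<beta>]]) (auto intro: El)
  qed
qed

lemma NegWNeg_mono2:
  assumes "{\<alpha>, \<beta>} \<turnstile>\<^sub>w \<gamma>" and "\<Gamma> \<turnstile>\<^sub>w NegWNeg n \<alpha>" and "\<Gamma> \<turnstile>\<^sub>w NegWNeg n \<beta>"
  shows "\<Gamma> \<turnstile>\<^sub>w NegWNeg n \<gamma>"
proof -
  have "{NegWNeg n \<alpha>, NegWNeg n \<beta>} \<turnstile>\<^sub>w NegWNeg n \<gamma>"
  proof (induction n)
    case (Suc n)
    show ?case
      unfolding NegWNeg.simps by (rule NegWNeg_1_mono2[OF Suc]) (simp_all add: El)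
  qed (simp add: assms(1))
  then have "\<Gamma> \<turnstile>\<^sub>w NegWNeg n \<alpha> \<^bold>\<rightarrow> NegWNeg n \<beta> \<^bold>\<rightarrow> NegWNeg n \<gamma>"
    by (intro deduction) (erule wBIL_mono, blast)
  then show ?thesis
    by (rule MP[OF assms(3) MP[OF assms(2)]])
qed

lemma NegWNeg_theorem: "{} \<turnstile>\<^sub>w \<phi> \<Longrightarrow> \<Gamma> \<turnstile>\<^sub>w NegWNeg n \<phi>"
  by (induction n arbitrary: \<Gamma>) (simp_all add: wDN wBIL_mono[OF _ empty_subsetI])

text \<open>The recursion adds boxes on the outside; moving one to the inside matches the boxed
  premises of the congruence for exclusion.\<close>

lemma NegWNeg_shift: "NegWNeg n (\<^bold>\<not> \<^bold>\<sim> \<phi>) = NegWNeg (Suc n) \<phi>"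
  by (induction n) auto

section \<open>Congruence\<close>

lemma And_cong: "{\<phi> \<^bold>\<leftrightarrow> \<phi>', \<psi> \<^bold>\<leftrightarrow> \<psi>'} \<turnstile>\<^sub>w (\<phi> \<^bold>\<and> \<psi>) \<^bold>\<leftrightarrow> (\<phi>' \<^bold>\<and> \<psi>')"
proof (intro Iff_intro And_intro)
  let ?\<Gamma> = "insert (\<phi> \<^bold>\<and> \<psi>) {\<phi> \<^bold>\<leftrightarrow> \<phi>', \<psi> \<^bold>\<leftrightarrow> \<psi>'}"
  have *: "?\<Gamma> \<turnstile>\<^sub>w \<phi> \<^bold>\<and> \<psi>" by (simp add: El)
  show "?\<Gamma> \<turnstile>\<^sub>w \<phi>'" by (rule Iff_elim1[OF _ And_elim1[OF *]]) simp
  show "?\<Gamma> \<turnstile>\<^sub>w \<psi>'" by (rule Iff_elim1[OF _ And_elim2[OF *]]) simp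
next
  let ?\<Gamma> = "insert (\<phi>' \<^bold>\<and> \<psi>') {\<phi> \<^bold>\<leftrightarrow> \<phi>', \<psi> \<^bold>\<leftrightarrow> \<psi>'}"
  have *: "?\<Gamma> \<turnstile>\<^sub>w \<phi>' \<^bold>\<and> \<psi>'" by (simp add: El)
  show "?\<Gamma> \<turnstile>\<^sub>w \<phi>" by (rule Iff_elim2[OF _ And_elim1[OF *]]) simp
  show "?\<Gamma> \<turnstile>\<^sub>w \<psi>" by (rule Iff_elim2[OF _ And_elim2[OF *]]) simp
qed

lemma Or_cong: "{\<phi> \<^bold>\<leftrightarrow> \<phi>', \<psi> \<^bold>\<leftrightarrow> \<psi>'} \<turnstile>\<^sub>w (\<phi> \<^bold>\<or> \<psi>) \<^bold>\<leftrightarrow> (\<phi>' \<^bold>\<or> \<psi>')"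
proof (rule Iff_intro)
  show "insert (\<phi> \<^bold>\<or> \<psi>) {\<phi> \<^bold>\<leftrightarrow> \<phi>', \<psi> \<^bold>\<leftrightarrow> \<psi>'} \<turnstile>\<^sub>w \<phi>' \<^bold>\<or> \<psi>'"
    by (rule Or_elim[of _ \<phi> \<psi>])
      (auto intro: El Or_intro1[OF Iff_elim1[of \<phi>]] Or_intro2[OF Iff_elim1[of \<psi>]])
  show "insert (\<phi>' \<^bold>\<or> \<psi>') {\<phi> \<^bold>\<leftrightarrow> \<phi>', \<psi> \<^bold>\<leftrightarrow> \<psi>'} \<turnstile>\<^sub>w \<phi> \<^bold>\<or> \<psi>"
    by (rule Or_elim[of _ \<phi>' \<psi>'])
      (auto intro: El Or_intro1[OF Iff_elim2[of _ \<phi>']] Or_intro2[OF Iff_elim2[of _ \<psi>']])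
qed

lemma Imp_cong: "{\<phi> \<^bold>\<leftrightarrow> \<phi>', \<psi> \<^bold>\<leftrightarrow> \<psi>'} \<turnstile>\<^sub>w (\<phi> \<^bold>\<rightarrow> \<psi>) \<^bold>\<leftrightarrow> (\<phi>' \<^bold>\<rightarrow> \<psi>')"
proof (intro Iff_intro deduction)
  let ?\<Gamma> = "insert \<phi>' (insert (\<phi> \<^bold>\<rightarrow> \<psi>) {\<phi> \<^bold>\<leftrightarrow> \<phi>', \<psi> \<^bold>\<leftrightarrow> \<psi>'})"
  have "?\<Gamma> \<turnstile>\<^sub>w \<phi>" by (rule Iff_elim2[of _ \<phi>']) (auto intro: El)
  then have "?\<Gamma> \<turnstile>\<^sub>w \<psi>" by (rule MP) (simp add: El)
  then show "?\<Gamma> \<turnstile>\<^sub>w \<psi>'" by (rule Iff_elim1[rotated]) simp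
next
  let ?\<Gamma> = "insert \<phi> (insert (\<phi>' \<^bold>\<rightarrow> \<psi>') {\<phi> \<^bold>\<leftrightarrow> \<phi>', \<psi> \<^bold>\<leftrightarrow> \<psi>'})"
  have "?\<Gamma> \<turnstile>\<^sub>w \<phi>'" by (rule Iff_elim1[of \<phi>]) (auto intro: El)
  then have "?\<Gamma> \<turnstile>\<^sub>w \<psi>'" by (rule MP) (simp add: El)
  then show "?\<Gamma> \<turnstile>\<^sub>w \<psi>" by (rule Iff_elim2[rotated]) simp
qed

text \<open>Exclusion is monotone on the left and antitone on the right. Residuation reduces the
  claim to \<phi> \<rightarrow> \<psi> \<or> (\<phi>' \<prec> \<psi>'), obtained from
  \<open>A11\<close> for \<phi>' and \<psi>'; it must hold boxed, hence the boxes on \<alpha> and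
  \<beta>.\<close>

lemma Excl_cong_half:
  assumes "{\<alpha>, \<beta>, \<phi>} \<turnstile>\<^sub>w \<phi>'" and "{\<alpha>, \<beta>, \<psi>'} \<turnstile>\<^sub>w \<psi>"
  shows "{\<^bold>\<not> \<^bold>\<sim> \<alpha>, \<^bold>\<not> \<^bold>\<sim> \<beta>} \<turnstile>\<^sub>w (\<phi> \<^bold>\<prec> \<psi>) \<^bold>\<rightarrow> (\<phi>' \<^bold>\<prec> \<psi>')"
proof -
  have "insert \<phi> {\<alpha>, \<beta>} \<turnstile>\<^sub>w \<psi> \<^bold>\<or> (\<phi>' \<^bold>\<prec> \<psi>')"
  proof (rule Or_elim[of _ \<psi>' "\<phi>' \<^bold>\<prec> \<psi>'"])
    show "insert \<phi> {\<alpha>, \<beta>} \<turnstile>\<^sub>w \<psi>' \<^bold>\<or> (\<phi>' \<^bold>\<prec> \<psi>')"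
      by (rule Excl_cases[OF wBIL_mono[OF assms(1)]]) blast
    show "insert \<psi>' (insert \<phi> {\<alpha>, \<beta>}) \<turnstile>\<^sub>w \<psi> \<^bold>\<or> (\<phi>' \<^bold>\<prec> \<psi>')"
      by (rule Or_intro1[OF wBIL_mono[OF assms(2)]]) blast
  qed (simp add: Or_intro2 El)
  then have "{\<alpha>, \<beta>} \<turnstile>\<^sub>w \<phi> \<^bold>\<rightarrow> \<psi> \<^bold>\<or> (\<phi>' \<^bold>\<prec> \<psi>')"
    by (rule deduction)
  then show ?thesis
    by (rule dual_residuation[OF NegWNeg_1_mono2]) (simp_all add: El)
qed

lemma Excl_cong:
  "{\<^bold>\<not> \<^bold>\<sim> (\<phi> \<^bold>\<leftrightarrow> \<phi>'), \<^bold>\<not> \<^bold>\<sim> (\<psi> \<^bold>\<leftrightarrow> \<psi>')} \<turnstile>\<^sub>w (\<phi> \<^bold>\<prec> \<psi>) \<^bold>\<leftrightarrow> (\<phi>' \<^bold>\<prec> \<psi>')"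
  \<comment> \<open>Only the outer equivalence is split, so \<alpha> and \<beta> can be the two
    argument equivalences in both halves. The four remaining goals each carry one argument across
    its equivalence.\<close>
  unfolding Iff_def[of "\<phi> \<^bold>\<prec> \<psi>"]
  by (intro And_intro Excl_cong_half)
    (rule Iff_elim1[OF _ El, of \<phi>] Iff_elim2[OF _ El, of _ \<phi>']
      Iff_elim1[OF _ El, of \<psi>] Iff_elim2[OF _ El, of _ \<psi>'], simp, simp)+

section \<open>The equivalence formulas\<close>

lemma subst_NegWNeg: "subst \<sigma> (NegWNeg n \<phi>) = NegWNeg n (subst \<sigma> \<phi>)"
  by (induction n) (auto simp: Neg_def WNeg_def)

text \<open>Distinctness matters: if x and y coincided, the update at y would override the one at
  x.\<close>

lemma inst2_Delta:
  assumes "x \<noteq> y"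
  shows "inst2 x y (Delta x y) \<phi> \<psi> = range (\<lambda>n. NegWNeg n (\<phi> \<^bold>\<leftrightarrow> \<psi>))"
  using assms by (simp add: inst2_def Delta_def full_SetCompr_eq image_image subst_NegWNeg Iff_def)

text \<open>The hypothesis ranges over all indices, not just the one in the conclusion, because
  exclusion draws on the next index.\<close>

lemma conn_app_congruence:
  assumes "length \<phi>s = arity c" and "length \<psi>s = arity c"
    and hyp: "\<And>i n. i < arity c \<Longrightarrow> \<Gamma> \<turnstile>\<^sub>w NegWNeg n (\<phi>s ! i \<^bold>\<leftrightarrow> \<psi>s ! i)"
  shows "\<Gamma> \<turnstile>\<^sub>w NegWNeg n (conn_app c \<phi>s \<^bold>\<leftrightarrow> conn_app c \<psi>s)"
proof (cases "arity c = 0")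
  case True
  with assms(1,2) show ?thesis by (simp add: NegWNeg_theorem Iff_refl)
next
  case False
  then have ar: "arity c = 2" by (cases c) auto
  with assms(1,2) obtain \<phi> \<phi>' \<psi> \<psi>' where lists: "\<phi>s = [\<phi>, \<psi>]" "\<psi>s = [\<phi>', \<psi>']"
    by (auto simp: numeral_2_eq_2 length_Suc_conv)
  have \<phi>: "\<Gamma> \<turnstile>\<^sub>w NegWNeg m (\<phi> \<^bold>\<leftrightarrow> \<phi>')" and \<psi>: "\<Gamma> \<turnstile>\<^sub>w NegWNeg m (\<psi> \<^bold>\<leftrightarrow> \<psi>')" for m
    using hyp[of 0 m] hyp[of 1 m] by (simp_all add: ar lists)
  show ?thesis
  proof (cases c)
    case CAnd
    then show ?thesis by (simp add: lists NegWNeg_mono2[OF And_cong \<phi> \<psi>])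
  next
    case COr
    then show ?thesis by (simp add: lists NegWNeg_mono2[OF Or_cong \<phi> \<psi>])
  next
    case CImp
    then show ?thesis by (simp add: lists NegWNeg_mono2[OF Imp_cong \<phi> \<psi>])
  next
    case CExcl
    \<comment> \<open>The hypotheses are used at index \<open>Suc n\<close>: the innermost box feeds
      \<open>Excl_cong\<close> and the other \<open>n\<close> are carried along.\<close>
    have "\<Gamma> \<turnstile>\<^sub>w NegWNeg n (\<phi> \<^bold>\<prec> \<psi> \<^bold>\<leftrightarrow> \<phi>' \<^bold>\<prec> \<psi>')"
      by (rule NegWNeg_mono2[OF Excl_cong]) (simp_all only: NegWNeg_shift \<phi> \<psi>)
    with CExcl show ?thesis by (simp add: lists)
  qed (use ar in simp_all)
qed

theorem mainTheorem5:
  fixes x y :: "'p :: {countable, infinite}"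
    and \<Delta> :: "'p form \<Rightarrow> 'p form \<Rightarrow> 'p form set"
  assumes "x \<noteq> y"
  defines "\<Delta> \<equiv> inst2 x y (Delta x y)"
  shows "{} \<tturnstile>\<^sub>w \<Delta> (Var x) (Var x)
    \<and> {Var x} \<union> \<Delta> (Var x) (Var y) \<turnstile>\<^sub>w Var y
    \<and> (\<forall>c xs ys. length xs = arity c \<and> length ys = arity c \<and> distinct (x # y # xs @ ys) \<longrightarrow>
        (\<Union>i<arity c. \<Delta> (Var (xs ! i)) (Var (ys ! i)))
          \<tturnstile>\<^sub>w \<Delta> (conn_app c (map Var xs)) (conn_app c (map Var ys)))"
proof (intro conjI allI impI)
  note \<Delta> = \<Delta>_def inst2_Delta[OF \<open>x \<noteq> y\<close>]
  show "{} \<tturnstile>\<^sub>w \<Delta> (Var x) (Var x)"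
    by (auto simp: \<Delta> wBIL_set_def intro: NegWNeg_theorem Iff_refl)
  \<comment> \<open>The member of index 0 is the bare equivalence, which is all that detachment
    uses.\<close>
  have "(Var x \<^bold>\<leftrightarrow> Var y) \<in> \<Delta> (Var x) (Var y)"
    unfolding \<Delta> by (rule range_eqI[of _ _ 0]) simp
  then show "{Var x} \<union> \<Delta> (Var x) (Var y) \<turnstile>\<^sub>w Var y"
    by (intro Iff_elim1[OF _ El, of "Var x"]) simp_all
  fix c and xs ys :: "'p list"
  assume "length xs = arity c \<and> length ys = arity c \<and> distinct (x # y # xs @ ys)"
  then have len: "length xs = arity c" "length ys = arity c" by auto
  show "(\<Union>i<arity c. \<Delta> (Var (xs ! i)) (Var (ys ! i)))
      \<tturnstile>\<^sub>w \<Delta> (conn_app c (map Var xs)) (conn_app c (map Var ys))" (is "?\<Gamma> \<tturnstile>\<^sub>w _")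
  proof -
    have "?\<Gamma> \<turnstile>\<^sub>w NegWNeg n (map Var xs ! i \<^bold>\<leftrightarrow> map Var ys ! i)" if "i < arity c" for i n
      using that len by (intro El) (auto simp: \<Delta>)
    then show ?thesis
      unfolding wBIL_set_def by (auto simp: \<Delta> len intro!: conn_app_congruence)
  qed
qed

end
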